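(* Let $p$ be a prime, let $\alpha \in \mathbb{N}$, let $F$ be a finite field of characteristic $p$ with $q = p^{\alpha}$ elements, and let $f_1,\ldots,f_r \in F[x_1,\ldots,x_N]$. For each $i$, let $\overline{f_i} : F^N \to F$ be the function induced by $f_i$. If $$N \alpha (p-1) > \sum_{i=1}^r (|\operatorname{Range}(\overline{f_i})| - 1)\, \deg_p(f_i),$$ then $p$ divides $|V(f_1,\ldots,f_r)|$, where $V(f_1,\ldots,f_r) := \{\mathbf{a} \in F^N \mid f_1(\mathbf{a}) = \cdots = f_r(\mathbf{a}) = 0\}$.
   Context: $\mathbb{N}$ is the set of positive integers; $\operatorname{Range}(g)$ is the image of a function $g$. For a prime $p$ and $n \in \mathbb{N}_0 = \mathbb{N}\cup\{0\}$, $s_p(n)$ denotes the digit sum of $n$ in base $p$. For a field $F$ of characteristic $p$, the $p$-weight degree of a monomial $c \prod_{i=1}^N x_i^{e_i}$ with $c \in F\setminus\{0\}$ is $\sum_{i=1}^N s_p(e_i)$. The $p$-weight degree $\deg_p(f)$ of a nonzero polynomial $f \in F[x_1,\ldots,x_N]$ is the maximum of the $p$-weight degrees of its monomials, and $\deg_p(0) := 0$. *)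

theory Defs
  imports "HOL-Computational_Algebra.Primes" "HOL-Library.Poly_Mapping" "HOL-Library.Cardinality"
begin

text \<open>
  Polynomials over \<open>'a\<close> whose variables are indexed by \<open>'n\<close>: a finitely supported map from exponent
  vectors to coefficients. For finite \<open>'n\<close> this is the polynomial ring in \<open>CARD('n)\<close> variables, and
  the affine space of points is the function type \<open>'n \<Rightarrow> 'a\<close>.
\<close>

type_synonym ('n, 'a) mvpoly = "('n \<Rightarrow>\<^sub>0 nat) \<Rightarrow>\<^sub>0 'a"

definition mveval :: "('n::finite, 'a::comm_semiring_1) mvpoly \<Rightarrow> ('n \<Rightarrow> 'a) \<Rightarrow> 'a" where
  "mveval f a = (\<Sum>m\<in>Poly_Mapping.keys f. Poly_Mapping.lookup f m * (\<Prod>i\<in>UNIV. a i ^ Poly_Mapping.lookup m i))"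

text \<open>Digit sum in base \<open>p\<close>; the guard \<open>p < 2\<close> only serves termination.\<close>

fun digit_sum :: "nat \<Rightarrow> nat \<Rightarrow> nat" where
  "digit_sum p n = (if n = 0 \<or> p < 2 then 0 else n mod p + digit_sum p (n div p))"

declare digit_sum.simps [simp del]

definition monom_pweight :: "nat \<Rightarrow> ('n::finite \<Rightarrow>\<^sub>0 nat) \<Rightarrow> nat" where
  "monom_pweight p m = (\<Sum>i\<in>UNIV. digit_sum p (Poly_Mapping.lookup m i))"

definition pweight_degree :: "nat \<Rightarrow> ('n::finite, 'a::zero) mvpoly \<Rightarrow> nat" where
  "pweight_degree p f = (if f = 0 then 0 else Max (monom_pweight p ` Poly_Mapping.keys f))"

definition common_zeros :: "(nat \<Rightarrow> ('n::finite, 'a::comm_semiring_1) mvpoly) \<Rightarrow> nat \<Rightarrow> ('n \<Rightarrow> 'a) set" where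
  "common_zeros f r = {a. \<forall>i\<in>{1..r}. mveval (f i) a = 0}"

end

theory Submission
  imports Defs "HOL-Library.FuncSet" "HOL-Computational_Algebra.Polynomial"
begin

text \<open>
  If \<open>0\<close> is a value of every \<open>f\<^sub>i\<close>, then modulo \<open>p\<close> the number of common zeros is the sum over all
  points of \<open>\<Prod>\<^sub>i \<Prod>\<^sub>c (1 - f\<^sub>i / c)\<close>, where \<open>c\<close> runs through the nonzero values of \<open>f\<^sub>i\<close>.
  Since digit sums are subadditive, this product is a combination of monomials of \<open>p\<close>-weight less
  than \<open>N \<alpha> (p - 1)\<close>. In each of them some variable has an exponent \<open>e\<close> of digit sum less than
  \<open>\<alpha> (p - 1)\<close>; every positive multiple of \<open>q - 1\<close> has digit sum at least \<open>\<alpha> (p - 1)\<close>, so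
  \<open>\<Sum>\<^sub>x x\<^sup>e = 0\<close> and the monomial sums to zero over the whole space.
\<close>

section \<open>Digit sums\<close>

lemma digit_sum_0 [simp]: "digit_sum p 0 = 0"
  by (simp add: digit_sum.simps)

lemma digit_sum_rec: "p \<ge> 2 \<Longrightarrow> digit_sum p n = n mod p + digit_sum p (n div p)"
  by (cases "n = 0") (simp_all add: digit_sum.simps[of p n])

lemma digit_sum_mult_add:
  assumes "p \<ge> 2" "c < p"
  shows "digit_sum p (n * p + c) = digit_sum p n + c"
  using assms by (subst digit_sum_rec) simp_all

text \<open>Either the last digit grows by 1, or a last digit \<open>p - 1\<close> becomes 0 and a
  carry moves to the higher digits, where induction applies.\<close>

lemma digit_sum_Suc_le:
  assumes "p \<ge> 2"
  shows "digit_sum p (Suc n) \<le> Suc (digit_sum p n)"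
proof (induction n rule: less_induct)
  case (less n)
  define u c where "u = n div p" and "c = n mod p"
  have n: "n = u * p + c" and c: "c < p" using assms by (simp_all add: u_def c_def)
  show ?case
  proof (cases "Suc c < p")
    case True
    then show ?thesis using digit_sum_mult_add[OF assms True, of u] digit_sum_mult_add[OF assms c, of u] n
      by simp
  next
    case False
    then have "Suc n = Suc u * p + 0" using n c by simp
    then have "digit_sum p (Suc n) = digit_sum p (Suc u)"
      using digit_sum_mult_add[of p 0 "Suc u"] assms by simp
    moreover have "u < n" if "n \<noteq> 0" using that assms by (simp add: u_def)
    moreover have "n \<noteq> 0" using False assms by (cases "n = 0") (simp_all add: c_def)
    ultimately show ?thesis
      using less.IH[of u] digit_sum_mult_add[OF assms c, of u] n False assms by simp
  qed
qed

text \<open>A carry out of the last place lowers the last digit by \<open>p\<close> and costs at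
  most 1 in the higher digits, by \<open>digit_sum_Suc_le\<close>.\<close>

lemma digit_sum_add_le:
  assumes "p \<ge> 2"
  shows "digit_sum p (m + n) \<le> digit_sum p m + digit_sum p n"
proof (induction m arbitrary: n rule: less_induct)
  case (less m)
  show ?case
  proof (cases "m = 0")
    case False
    define u c where "u = m div p" and "c = m mod p"
    define v d where "v = n div p" and "d = n mod p"
    have m: "m = u * p + c" and c: "c < p" using assms by (simp_all add: u_def c_def)
    have n: "n = v * p + d" and d: "d < p" using assms by (simp_all add: v_def d_def)
    have dm: "digit_sum p m = digit_sum p u + c" using digit_sum_mult_add[OF assms c, of u] m by simp
    have dn: "digit_sum p n = digit_sum p v + d" using digit_sum_mult_add[OF assms d, of v] n by simp
    have "u < m" using False assms by (simp add: u_def)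
    then have IH: "digit_sum p (u + v) \<le> digit_sum p u + digit_sum p v" by (rule less.IH)
    show ?thesis
    proof (cases "c + d < p")
      case True
      have "m + n = (u + v) * p + (c + d)" by (simp add: m n algebra_simps)
      then have "digit_sum p (m + n) = digit_sum p (u + v) + (c + d)"
        using digit_sum_mult_add[OF assms True, of "u + v"] by simp
      then show ?thesis using IH dm dn by simp
    next
      case False
      have "m + n = Suc (u + v) * p + (c + d - p)" using False by (simp add: m n algebra_simps)
      then have "digit_sum p (m + n) = digit_sum p (Suc (u + v)) + (c + d - p)"
        using digit_sum_mult_add[of p "c + d - p" "Suc (u + v)"] assms c d by simp
      then show ?thesis using IH dm dn digit_sum_Suc_le[OF assms, of "u + v"] False assms by simp
    qed
  qed simp
qed

lemma digit_sum_power_mult_add: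
  assumes "p \<ge> 2" "b < p ^ k"
  shows "digit_sum p (a * p ^ k + b) = digit_sum p a + digit_sum p b"
  using assms(2)
proof (induction k arbitrary: b)
  case (Suc k)
  define v d where "v = b div p" and "d = b mod p"
  have b: "b = v * p + d" and d: "d < p" using assms by (simp_all add: v_def d_def)
  have "v < p ^ k" using Suc.prems by (simp add: v_def less_mult_imp_div_less mult.commute)
  then have "digit_sum p (a * p ^ k + v) = digit_sum p a + digit_sum p v" by (rule Suc.IH)
  moreover have "a * p ^ Suc k + b = (a * p ^ k + v) * p + d" by (simp add: b algebra_simps)
  ultimately have "digit_sum p (a * p ^ Suc k + b) = digit_sum p a + digit_sum p v + d"
    using digit_sum_mult_add[OF assms(1) d] by metis
  then show ?case using digit_sum_mult_add[OF assms(1) d, of v] by (simp add: b)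
qed simp

lemma digit_sum_power_minus_1:
  assumes "p \<ge> 2"
  shows "digit_sum p (p ^ k - 1) = k * (p - 1)"
proof (induction k)
  case (Suc k)
  have "p ^ k \<ge> 1" using assms by simp
  then have "p ^ Suc k - 1 = (p ^ k - 1) * p + (p - 1)"
    using assms by (simp add: algebra_simps)
  then have "digit_sum p (p ^ Suc k - 1) = digit_sum p (p ^ k - 1) + (p - 1)"
    using digit_sum_mult_add[of p "p - 1" "p ^ k - 1"] assms by simp
  then show ?case using Suc by simp
qed simp

text \<open>Folding the base-\<open>p ^ k\<close> digits onto one another preserves the class modulo \<open>p ^ k - 1\<close> and
  does not increase the digit sum, so the least positive multiple is the extremal case.\<close>

lemma digit_sum_multiple_ge:
  assumes "p \<ge> 2" "k \<ge> 1" "e > 0" "(p ^ k - 1) dvd e"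
  shows "digit_sum p e \<ge> k * (p - 1)"
  using assms(3,4)
proof (induction e rule: less_induct)
  case (less e)
  have q: "p ^ k \<ge> 2" using assms power_increasing[of 1 k p] by simp
  show ?case
  proof (cases "e < p ^ k")
    case True
    moreover have "p ^ k - 1 \<le> e" using less.prems by (intro dvd_imp_le)
    ultimately have "e = p ^ k - 1" by linarith
    then show ?thesis using digit_sum_power_minus_1[OF assms(1), of k] by simp
  next
    case False
    define a b where "a = e div p ^ k" and "b = e mod p ^ k"
    have e: "e = a * p ^ k + b" unfolding a_def b_def by (rule div_mult_mod_eq [symmetric])
    have b: "b < p ^ k" unfolding b_def using q by (intro mod_less_divisor) linarith
    have a: "a > 0" using False assms(1) by (simp add: a_def div_greater_zero_iff)
    \<comment> \<open>With \<open>t\<close> for \<open>p ^ k - 1\<close>, passing from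
      \<open>e\<close> to \<open>a + b\<close> subtracts \<open>a * t\<close>: this keeps
      divisibility and strictly decreases, as \<open>a > 0\<close>.\<close>
    obtain t where t: "p ^ k = Suc t" "t > 0" using q by (cases "p ^ k") auto
    have "e = a * t + (a + b)" using e t by simp
    moreover have "a + b < a * t + (a + b)" using a t by simp
    moreover have "t dvd a * t + (a + b)" using less.prems(2) t \<open>e = a * t + (a + b)\<close> by simp
    then have "t dvd a + b" by (subst (asm) dvd_add_right_iff) simp_all
    ultimately have "(p ^ k - 1) dvd (a + b)" "a + b < e" using t by simp_all
    then have "k * (p - 1) \<le> digit_sum p (a + b)" using less.IH a by simp
    also have "\<dots> \<le> digit_sum p a + digit_sum p b" by (rule digit_sum_add_le[OF assms(1)])
    also have "\<dots> = digit_sum p e" using digit_sum_power_mult_add[OF assms(1) b, of a] e by simp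
    finally show ?thesis .
  qed
qed

section \<open>Power sums over a finite field\<close>

text \<open>Multiplication by \<open>b\<close> permutes the nonzero elements, and their product
  cancels.\<close>

lemma finite_field_power_card_minus_1:
  fixes b :: "'a::{field,finite}"
  assumes "b \<noteq> 0"
  shows "b ^ (CARD('a) - 1) = 1"
proof -
  have "(\<Prod>x\<in>UNIV-{0}. x) = (\<Prod>x\<in>UNIV-{0}. b * x)"
    using assms
    by (intro prod.reindex_bij_witness[where i = "\<lambda>x. b * x" and j = "\<lambda>x. x / b"]) auto
  also have "\<dots> = b ^ (CARD('a) - 1) * (\<Prod>x\<in>UNIV-{0}. x)"
    by (simp add: prod.distrib card_Diff_singleton)
  finally show ?thesis by simp
qed

text \<open>On nonzero elements only the residue \<open>k\<close> of \<open>e\<close> modulo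
  \<open>CARD('a) - 1\<close> matters. As \<open>k\<close> is positive, \<open>X ^ k - 1\<close> is
  a nonzero polynomial with at most \<open>k\<close> roots, fewer than there are nonzero
  elements.\<close>

lemma finite_field_exists_power_neq_1:
  assumes "\<not> (CARD('a::{field,finite}) - 1) dvd e"
  obtains b :: "'a::{field,finite}" where "b \<noteq> 0" "b ^ e \<noteq> 1"
proof -
  define q k where "q = CARD('a) - 1" and "k = e mod q"
  have "card {0, 1 :: 'a} \<le> CARD('a)" by (rule card_mono) auto
  then have q: "q > 0" by (simp add: q_def)
  have k: "0 < k" "k < q" using assms q by (auto simp: k_def q_def dvd_eq_mod_eq_0)
  define P :: "'a poly" where "P = monom 1 k - 1"
  have "degree P = k"
    unfolding P_def using k degree_add_eq_left[of "-1" "monom (1::'a) k"] by (simp add: degree_monom_eq)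
  then have "P \<noteq> 0" using k by auto
  then have roots: "card {x. poly P x = 0} \<le> k"
    using card_poly_roots_bound[of P] \<open>degree P = k\<close> by simp
  have "\<not> UNIV - {0::'a} \<subseteq> {x. poly P x = 0}"
  proof
    assume "UNIV - {0::'a} \<subseteq> {x. poly P x = 0}"
    from card_mono[OF _ this] roots k show False by (simp add: q_def card_Diff_singleton)
  qed
  then obtain b where b: "b \<noteq> 0" "poly P b \<noteq> 0" by auto
  have "b ^ e = b ^ (q * (e div q) + k)" by (simp add: k_def)
  also have "\<dots> = b ^ k"
    using finite_field_power_card_minus_1[OF b(1)] by (simp add: power_add power_mult q_def)
  finally have "b ^ e \<noteq> 1" using b(2) by (simp add: P_def poly_monom)
  with b(1) show thesis by (rule that)
qed

text \<open>Substituting \<open>b * x\<close> for \<open>x\<close> scales the sum by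
  \<open>b ^ e\<close>, which can be chosen different from 1.\<close>

lemma finite_field_power_sum_eq_0:
  assumes "\<not> (CARD('a::{field,finite}) - 1) dvd e"
  shows "(\<Sum>x\<in>(UNIV::'a::{field,finite} set). x ^ e) = 0"
proof -
  obtain b :: 'a where b: "b \<noteq> 0" "b ^ e \<noteq> 1"
    using finite_field_exists_power_neq_1[OF assms] .
  have "(\<Sum>x\<in>(UNIV::'a set). x ^ e) = (\<Sum>x\<in>UNIV. (b * x) ^ e)"
    using b(1) by (intro sum.reindex_bij_witness[where i = "\<lambda>x. b * x" and j = "\<lambda>x. x / b"]) auto
  also have "\<dots> = b ^ e * (\<Sum>x\<in>UNIV. x ^ e)" by (simp add: power_mult_distrib sum_distrib_left)
  finally show ?thesis using b(2) by simp
qed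

lemma power_sum_eq_0_if_digit_sum_less:
  assumes "p \<ge> 2" "\<alpha> \<ge> 1" "CHAR('a::{field,finite}) = p" "CARD('a) = p ^ \<alpha>"
    and "digit_sum p e < \<alpha> * (p - 1)"
  shows "(\<Sum>x\<in>(UNIV::'a::{field,finite} set). x ^ e) = 0"
proof (cases "e = 0")
  case True
  \<comment> \<open>\<open>CARD('a) - 1\<close> divides 0, so this exponent is separate: all terms
    are 1, also at \<open>x = 0\<close>, and the sum is the field size, which vanishes in
    characteristic \<open>p\<close>.\<close>
  have "p dvd p ^ \<alpha>" using assms(2) by simp
  then have "of_nat (CARD('a)) = (0 :: 'a)" using assms(3,4) of_nat_eq_0_iff_char_dvd by metis
  then show ?thesis using True by simp
next
  case False
  then show ?thesis
    using digit_sum_multiple_ge[of p \<alpha> e] finite_field_power_sum_eq_0[where 'a = 'a, of e] assms by fastforce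
qed

section \<open>Functions of bounded weight\<close>

text \<open>A class of functions rather than polynomials: products and sums are taken pointwise, and
  cancellation between monomials never has to be tracked. Accordingly \<open>d\<close> is only an
  upper bound.\<close>

inductive weight_le :: "nat \<Rightarrow> nat \<Rightarrow> (('n::finite \<Rightarrow> 'a::comm_semiring_1) \<Rightarrow> 'a) \<Rightarrow> bool"
  for p d where
  monomial: "(\<Sum>i\<in>UNIV. digit_sum p (e i)) \<le> d \<Longrightarrow> weight_le p d (\<lambda>a. c * (\<Prod>i\<in>UNIV. a i ^ e i))"
| add: "weight_le p d g \<Longrightarrow> weight_le p d h \<Longrightarrow> weight_le p d (\<lambda>a. g a + h a)"

lemma weight_le_const: "weight_le p d (\<lambda>a. c)"
  using weight_le.monomial[of p "\<lambda>_. 0" d c] by simp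

lemma weight_le_sum:
  assumes "\<And>x. x \<in> A \<Longrightarrow> weight_le p d (g x)"
  shows "weight_le p d (\<lambda>a. \<Sum>x\<in>A. g x a)"
  using assms
  by (induction A rule: infinite_finite_induct) (auto intro: weight_le_const weight_le.add)

text \<open>Exponents add under multiplication, so subadditivity of digit sums gives the bound. This
  is the inner induction, on the right factor, for \<open>weight_le_mult\<close>.\<close>

lemma weight_le_monomial_mult:
  assumes "p \<ge> 2" "weight_le p d' h" "(\<Sum>i\<in>UNIV. digit_sum p (e i)) \<le> d"
  shows "weight_le p (d + d') (\<lambda>a. c * (\<Prod>i\<in>UNIV. a i ^ e i) * h a)"
  using assms(2)
proof (induction rule: weight_le.induct)
  case (monomial e' c')
  have "(\<Sum>i\<in>UNIV. digit_sum p (e i + e' i)) \<le> (\<Sum>i\<in>UNIV. digit_sum p (e i) + digit_sum p (e' i))"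
    by (intro sum_mono digit_sum_add_le[OF assms(1)])
  also have "\<dots> \<le> d + d'" using assms(3) monomial by (simp add: sum.distrib)
  finally have "weight_le p (d + d') (\<lambda>a. (c * c') * (\<Prod>i\<in>UNIV. a i ^ (e i + e' i)))"
    by (rule weight_le.monomial)
  then show ?case by (simp add: power_add prod.distrib mult_ac)
next
  case (add g h)
  then show ?case by (simp add: distrib_left weight_le.add)
qed

lemma weight_le_mult:
  assumes "p \<ge> 2" "weight_le p d g" "weight_le p d' h"
  shows "weight_le p (d + d') (\<lambda>a. g a * h a)"
  using assms(2)
proof (induction rule: weight_le.induct)
  case (monomial e c)
  with assms show ?case by (intro weight_le_monomial_mult)
next
  case (add g1 g2)
  then show ?case by (simp add: distrib_right weight_le.add)
qed

lemma weight_le_prod: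
  assumes "p \<ge> 2" "finite A" "\<And>x. x \<in> A \<Longrightarrow> weight_le p (d x) (g x)"
  shows "weight_le p (\<Sum>x\<in>A. d x) (\<lambda>a. \<Prod>x\<in>A. g x a)"
  using assms(2,3)
  by (induction A rule: finite_induct) (auto intro: weight_le_const weight_le_mult[OF assms(1)])

lemma weight_le_mveval: "weight_le p (pweight_degree p f) (mveval f)"
proof -
  have "monom_pweight p m \<le> pweight_degree p f" if "m \<in> Poly_Mapping.keys f" for m
    using that by (auto simp: pweight_degree_def)
  then have "weight_le p (pweight_degree p f) (\<lambda>a. \<Sum>m\<in>Poly_Mapping.keys f.
      Poly_Mapping.lookup f m * (\<Prod>i\<in>UNIV. a i ^ Poly_Mapping.lookup m i))"
    by (intro weight_le_sum weight_le.monomial) (simp add: monom_pweight_def)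
  then show ?thesis by (simp add: mveval_def[abs_def])
qed

lemma sum_UNIV_eq_0_if_weight_less:
  fixes g :: "('n::finite \<Rightarrow> 'a::{field,finite}) \<Rightarrow> 'a"
  assumes "p \<ge> 2" "\<alpha> \<ge> 1" "CHAR('a) = p" "CARD('a) = p ^ \<alpha>"
    and "weight_le p d g" "d < CARD('n) * \<alpha> * (p - 1)"
  shows "(\<Sum>a\<in>UNIV. g a) = 0"
  using assms(5)
proof (induction rule: weight_le.induct)
  case (monomial e c)
  \<comment> \<open>Pigeonhole: otherwise the \<open>CARD('n)\<close> variables together would
    exceed the weight bound \<open>d\<close>.\<close>
  have "\<exists>i. digit_sum p (e i) < \<alpha> * (p - 1)"
  proof (rule ccontr)
    assume "\<not> ?thesis"
    then have "(\<Sum>i\<in>(UNIV::'n set). \<alpha> * (p - 1)) \<le> (\<Sum>i\<in>UNIV. digit_sum p (e i))"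
      by (intro sum_mono) (simp add: not_less)
    with monomial assms(6) show False by (simp add: mult.assoc)
  qed
  then obtain i where "(\<Sum>x\<in>(UNIV::'a set). x ^ e i) = 0"
    using power_sum_eq_0_if_digit_sum_less[OF assms(1-4)] by blast
  then have "(\<Prod>i\<in>UNIV. \<Sum>x\<in>(UNIV::'a set). x ^ e i) = 0" by (intro prod_zero) auto
  \<comment> \<open>By distributivity, summing a monomial over all points yields a product with one
    power sum per variable.\<close>
  moreover have "(\<Prod>i\<in>UNIV. \<Sum>x\<in>(UNIV::'a set). x ^ e i) = (\<Sum>a\<in>UNIV. \<Prod>i\<in>UNIV. a i ^ e i)"
    by (subst prod_sum_PiE) (simp_all add: PiE_UNIV_domain)
  ultimately show ?case by (simp flip: sum_distrib_left)
next
  case (add g h)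
  then show ?case by (simp add: sum.distrib)
qed

text \<open>Where \<open>g a\<close> is nonzero, the factor for \<open>c = g a\<close> vanishes;
  where \<open>g a = 0\<close>, all factors are 1. Since 0 is a value, exactly
  \<open>card (range g) - 1\<close> factors occur.\<close>

lemma weight_le_zero_indicator:
  fixes g :: "('n::finite \<Rightarrow> 'a::{field,finite}) \<Rightarrow> 'a"
  assumes "p \<ge> 2" "weight_le p d g" "0 \<in> range g"
  shows "weight_le p ((card (range g) - 1) * d) (\<lambda>a. of_bool (g a = 0))"
proof -
  have "weight_le p d (\<lambda>a. 1 + (- inverse c) * g a)" for c
    \<comment> \<open>The scalar is given weight 0, so that the factor keeps the bound
      \<open>d\<close>.\<close>
    using weight_le_mult[OF assms(1) weight_le_const[of p 0 "- inverse c"] assms(2)]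
    by (intro weight_le.add weight_le_const) simp
  then have "weight_le p (\<Sum>c\<in>range g - {0}. d) (\<lambda>a. \<Prod>c\<in>range g - {0}. 1 + (- inverse c) * g a)"
    by (intro weight_le_prod[OF assms(1)]) simp_all
  moreover have "(\<Prod>c\<in>range g - {0}. 1 + (- inverse c) * g a) = of_bool (g a = 0)" for a
    by (cases "g a = 0") (auto intro!: prod_zero bexI[of _ "g a"])
  ultimately show ?thesis using assms(3) by (simp add: card_Diff_singleton)
qed

theorem corollary13p6:
  fixes p \<alpha> r :: nat
    and f :: "nat \<Rightarrow> ('n::finite, 'a::{field,finite}) mvpoly"
  assumes "prime p"
    and "\<alpha> \<ge> 1"
    and "CHAR('a) = p"
    and "CARD('a) = p ^ \<alpha>"
    and "CARD('n) * \<alpha> * (p - 1) > (\<Sum>i=1..r. (card (range (mveval (f i))) - 1) * pweight_degree p (f i))"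
  shows "p dvd card (common_zeros f r)"
proof (cases "\<forall>i\<in>{1..r}. 0 \<in> range (mveval (f i))")
  case False
  \<comment> \<open>A polynomial without zeros would need one more factor than the hypothesis pays
    for, but then there are no common zeros at all.\<close>
  then obtain i where "i \<in> {1..r}" "0 \<notin> range (mveval (f i))" by blast
  then have "common_zeros f r = {}" by (force simp: common_zeros_def)
  then show ?thesis by simp
next
  case True
  have p: "p \<ge> 2" using assms(1) by (rule prime_ge_2_nat)
  define ind :: "('n \<Rightarrow> 'a) \<Rightarrow> 'a" where "ind a = (\<Prod>i=1..r. of_bool (mveval (f i) a = 0))" for a
  have ind: "ind a = of_bool (a \<in> common_zeros f r)" for a
    by (auto simp: ind_def common_zeros_def)
  have "weight_le p (\<Sum>i=1..r. (card (range (mveval (f i))) - 1) * pweight_degree p (f i)) ind"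
    unfolding ind_def[abs_def] using True
    by (intro weight_le_prod[OF p] weight_le_zero_indicator[OF p] weight_le_mveval) auto
  then have "(\<Sum>a\<in>UNIV. ind a) = 0"
    by (rule sum_UNIV_eq_0_if_weight_less[OF p assms(2-4) _ assms(5)])
  \<comment> \<open>The indicator takes values in the field, so its sum knows the number of zeros
    exactly modulo \<open>p\<close>.\<close>
  moreover have "(\<Sum>a\<in>UNIV. ind a) = of_nat (card (common_zeros f r))"
    by (simp add: ind)
  ultimately show ?thesis using assms(3) of_nat_eq_0_iff_char_dvd by metis
qed

end
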